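(* Let $j\geq 2$ be an integer and let $n,m\geq j$ be integers. If $f\in K_j^{[2]}$, then $$f(x,y)\leq B_{n,m,j}f(x,y)\leq B_{n,m}f(x,y)\quad\text{for all } (x,y)\in[0,1]^2.$$
   Context: $K_j^{[1]}$ is the set of all $f\in C[0,1]$ such that $f$ is increasing (in the weak sense, i.e. nondecreasing) and the function $g(x):=f(x^{1/j})$ is convex on $[0,1]$. $K_j^{[2]}$ is the set of all $f\in C([0,1]^2)$ such that $f(\cdot,y)\in K_j^{[1]}$ for every $y\in[0,1]$ and $f(x,\cdot)\in K_j^{[1]}$ for every $x\in[0,1]$. With $p_{n,i}(x)=\binom{n}{i}x^i(1-x)^{n-i}$, the bivariate Bernstein operator $B_{n,m}$ and the bivariate Aldaz-Kounchev-Render operator $B_{n,m,j}$ are defined for $f\in C([0,1]^2)$ by $$B_{n,m}f(x,y)=\sum_{i=0}^{n}\sum_{k=0}^{m}f\left(\frac{i}{n},\frac{k}{m}\right)p_{n,i}(x)p_{m,k}(y),\qquad B_{n,m,j}f(x,y)=\sum_{i=0}^{n}\sum_{k=0}^{m}f\left(t_{n,i}^j,t_{m,k}^j\right)p_{n,i}(x)p_{m,k}(y),$$ where $$t_{n,k}^j=\left(\frac{k(k-1)\cdots(k-j+1)}{n(n-1)\cdots(n-j+1)}\right)^{1/j}$$ (the superscript $j$ in $t_{n,k}^j$ is an index, not a power). *)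

theory Defs
  imports "HOL-Analysis.Analysis"
begin

text \<open>
  Functions on \<open>[0,1]\<close> and \<open>[0,1]\<^sup>2\<close> are total functions of which only the values on
  \<open>{0..1}\<close> and \<open>{0..1} \<times> {0..1}\<close> are constrained or used. The basis polynomial
  \<open>p\<^sub>n\<^sub>,\<^sub>i(x)\<close> is the library's \<^const>\<open>Bernstein\<close>, and \<open>x\<^sup>1\<^sup>/\<^sup>j\<close> is \<open>root j x\<close>, which is used
  only for nonnegative \<open>x\<close>.
\<close>

definition K1 :: "nat \<Rightarrow> (real \<Rightarrow> real) set" where
  "K1 j = {f. continuous_on {0..1} f \<and> mono_on {0..1} f \<and>
              convex_on {0..1} (\<lambda>x. f (root j x))}"

definition K2 :: "nat \<Rightarrow> (real \<times> real \<Rightarrow> real) set" where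
  "K2 j = {f. continuous_on ({0..1} \<times> {0..1}) f \<and>
              (\<forall>y\<in>{0..1}. (\<lambda>x. f (x, y)) \<in> K1 j) \<and>
              (\<forall>x\<in>{0..1}. (\<lambda>y. f (x, y)) \<in> K1 j)}"

text \<open>The factors are subtracted in the reals; for \<open>k < j\<close> the numerator contains the factor
  \<open>k - k\<close>, so the node is \<open>0\<close>. The denominator is nonzero for \<open>n \<ge> j\<close>.\<close>

definition akr_node :: "nat \<Rightarrow> nat \<Rightarrow> nat \<Rightarrow> real" where
  "akr_node j n k =
     root j ((\<Prod>i<j. real k - real i) / (\<Prod>i<j. real n - real i))"

definition bernstein_op2 :: "nat \<Rightarrow> nat \<Rightarrow> (real \<times> real \<Rightarrow> real) \<Rightarrow> real \<times> real \<Rightarrow> real" where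
  "bernstein_op2 n m f = (\<lambda>(x, y). \<Sum>i=0..n. \<Sum>k=0..m.
     f (real i / real n, real k / real m) * Bernstein n i x * Bernstein m k y)"

definition akr_op2 :: "nat \<Rightarrow> nat \<Rightarrow> nat \<Rightarrow> (real \<times> real \<Rightarrow> real) \<Rightarrow> real \<times> real \<Rightarrow> real" where
  "akr_op2 n m j f = (\<lambda>(x, y). \<Sum>i=0..n. \<Sum>k=0..m.
     f (akr_node j n i, akr_node j m k) * Bernstein n i x * Bernstein m k y)"

end

theory Submission
  imports Defs
begin

text \<open>
  Write \<open>t\<^sub>k\<close> for the node with index \<open>k\<close>. Its \<open>j\<close>-th power is the quotient of binomial
  coefficients \<open>(k choose j) / (n choose j)\<close>, and this makes the operator reproduce the monomial
  \<open>x\<^sup>j\<close>: the Bernstein average of the numbers \<open>t\<^sub>k\<^sup>j\<close> is \<open>x\<^sup>j\<close>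
  (\<open>sum_choose_quotient_Bernstein\<close>). If \<open>g(u) = f(u\<^sup>1\<^sup>/\<^sup>j)\<close> is convex, then Jensen's inequality for
  the weights \<open>p\<^sub>n\<^sub>,\<^sub>k(x)\<close> and the points \<open>t\<^sub>k\<^sup>j\<close> reads
  \<open>f(x) = g(x\<^sup>j) \<le> \<Sum>\<^sub>k g(t\<^sub>k\<^sup>j) p\<^sub>n\<^sub>,\<^sub>k(x) = \<Sum>\<^sub>k f(t\<^sub>k) p\<^sub>n\<^sub>,\<^sub>k(x)\<close>, which is the lower bound in one
  variable (\<open>K1_le_akr\<close>). In two variables it is applied to \<open>x\<close> first, and then to \<open>y\<close>
  on each line \<open>x = t\<^sub>i\<close>.

  The upper bound needs only monotonicity: \<open>t\<^sub>k\<close> is \<open>0\<close> for \<open>k < j\<close>, and for \<open>k \<ge> j\<close> every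
  factor \<open>(k - i) / (n - i)\<close> of \<open>t\<^sub>k\<^sup>j\<close> is nonnegative and at most \<open>k / n\<close>. Hence
  \<open>t\<^sub>k \<le> k / n\<close> (\<open>akr_node_le\<close>), and the two sums compare term by term.
\<close>

lemma akr_node_eq_choose:
  "akr_node j n k = root j (real (k choose j) / real (n choose j))"
proof -
  have falling: "(\<Prod>i<j. real a - real i) = fact j * real (a choose j)" for a
    by (simp add: binomial_gbinomial gbinomial_prod_rev atLeast0LessThan)
  show ?thesis
    unfolding akr_node_def falling by simp
qed

lemma choose_quotient_in_unit:
  assumes "k \<le> n"
  shows "real (k choose j) / real (n choose j) \<in> {0..1}"
  using binomial_right_mono[OF assms, of j] by (simp add: divide_le_eq)

lemma akr_node_in_unit:
  assumes "0 < j" "k \<le> n"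
  shows "akr_node j n k \<in> {0..1}"
  using choose_quotient_in_unit[OF assms(2), of j] assms(1)
  unfolding akr_node_eq_choose by auto

lemma akr_node_le:
  assumes "0 < j" "j \<le> n" "k \<le> n"
  shows "akr_node j n k \<le> real k / real n"
proof (cases "k < j")
  case True
  then show ?thesis by (simp add: akr_node_eq_choose binomial_eq_0)
next
  case False
  have "(\<Prod>i<j. real k - real i) / (\<Prod>i<j. real n - real i)
      = (\<Prod>i<j. (real k - real i) / (real n - real i))"
    by (simp add: prod_dividef)
  also have "\<dots> \<le> (\<Prod>i<j. real k / real n)"
  proof (rule prod_mono)
    fix i assume "i \<in> {..<j}"
    then have i: "i < j" by simp
    have "real i * real k \<le> real i * real n"
      using assms by (intro mult_left_mono) auto
    then show "0 \<le> (real k - real i) / (real n - real i) \<and>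
        (real k - real i) / (real n - real i) \<le> real k / real n"
      using i False assms by (auto simp: divide_simps algebra_simps)
  qed
  also have "\<dots> = (real k / real n) ^ j" by simp
  finally have "akr_node j n k \<le> root j ((real k / real n) ^ j)"
    unfolding akr_node_def using assms(1) by simp
  also have "\<dots> = real k / real n"
    using assms(1) by (simp add: real_root_power_cancel)
  finally show ?thesis .
qed

text \<open>
  By \<open>(n choose k) (k choose j) = (n choose j) (n - j choose k - j)\<close>, the sum is \<open>x\<^sup>j\<close> times the
  sum of all Bernstein polynomials of degree \<open>n - j\<close>, which is \<open>1\<close>.
\<close>

lemma sum_choose_quotient_Bernstein:
  assumes "j \<le> n"
  shows "(\<Sum>k\<le>n. Bernstein n k x * (real (k choose j) / real (n choose j))) = x ^ j"
proof -
  let ?h = "\<lambda>k. Bernstein n k x * (real (k choose j) / real (n choose j))"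
  have shift: "?h (l + j) = x ^ j * Bernstein (n - j) l x" if "l \<le> n - j" for l
  proof -
    have "(n choose (l + j)) * (l + j choose j) = (n choose j) * ((n - j) choose l)"
      using choose_mult[of j "l + j" n] that assms by simp
    then have "real (n choose (l + j)) * real (l + j choose j)
        = real (n choose j) * real ((n - j) choose l)"
      by (metis of_nat_mult)
    moreover have "real (n choose j) \<noteq> 0"
      using assms by simp
    ultimately have q: "real (n choose (l + j)) * (real (l + j choose j) / real (n choose j))
        = real ((n - j) choose l)"
      by (simp add: field_simps)
    have "?h (l + j) = (real (n choose (l + j)) * (real (l + j choose j) / real (n choose j)))
        * (x ^ (l + j) * (1 - x) ^ (n - (l + j)))"
      by (simp add: Bernstein_def)
    also have "\<dots> = x ^ j * Bernstein (n - j) l x"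
      unfolding q by (simp add: Bernstein_def power_add add.commute)
    finally show ?thesis .
  qed
  have "(\<Sum>k\<le>n. ?h k) = (\<Sum>k=j..n. ?h k)"
    by (rule sum.mono_neutral_right) (auto simp: binomial_eq_0)
  also have "\<dots> = (\<Sum>l\<le>n - j. ?h (l + j))"
    using sum.shift_bounds_cl_nat_ivl[of ?h 0 j "n - j"] assms
    by (simp add: atLeast0AtMost)
  also have "\<dots> = (\<Sum>l\<le>n - j. x ^ j * Bernstein (n - j) l x)"
    using shift by (intro sum.cong) auto
  also have "\<dots> = x ^ j"
    by (simp flip: sum_distrib_left)
  finally show ?thesis .
qed

lemma K1_le_akr:
  assumes j: "0 < j" "j \<le> n" and f: "f \<in> K1 j" and x: "x \<in> {0..1}"
  shows "f x \<le> (\<Sum>k\<le>n. Bernstein n k x * f (akr_node j n k))"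
proof -
  have cvx: "convex_on {0..1} (\<lambda>u. f (root j u))"
    using f by (simp add: K1_def)
  have "f x = f (root j (x ^ j))"
    using j x by (simp add: real_root_power_cancel)
  also have "\<dots> = f (root j (\<Sum>k\<le>n. Bernstein n k x *\<^sub>R (real (k choose j) / real (n choose j))))"
    using sum_choose_quotient_Bernstein[OF j(2), of x] by simp
  also have "\<dots> \<le> (\<Sum>k\<le>n. Bernstein n k x * f (root j (real (k choose j) / real (n choose j))))"
    using x choose_quotient_in_unit
    by (intro convex_on_sum[OF _ _ cvx]) (auto intro: Bernstein_nonneg)
  finally show ?thesis
    by (simp add: akr_node_eq_choose)
qed

lemma K2_mono:
  assumes "f \<in> K2 j" "0 \<le> a" "a \<le> a'" "a' \<le> 1" "0 \<le> b" "b \<le> b'" "b' \<le> 1"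
  shows "f (a, b) \<le> f (a', b')"
proof -
  have "mono_on {0..1} (\<lambda>x. f (x, b))" "mono_on {0..1} (\<lambda>y. f (a', y))"
    using assms by (auto simp: K2_def K1_def)
  then show ?thesis
    using assms mono_onD[of "{0..1}" "\<lambda>x. f (x, b)" a a']
      mono_onD[of "{0..1}" "\<lambda>y. f (a', y)" b b'] by simp
qed

theorem theorem4p1:
  fixes j n m :: nat and f :: "real \<times> real \<Rightarrow> real"
  assumes "j \<ge> 2" and "n \<ge> j" and "m \<ge> j"
    and "f \<in> K2 j"
  shows "\<forall>(x, y) \<in> {0..1} \<times> {0..1}.
    f (x, y) \<le> akr_op2 n m j f (x, y) \<and> akr_op2 n m j f (x, y) \<le> bernstein_op2 n m f (x, y)"
proof (clarify, intro conjI)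
  fix x y :: real
  assume x: "x \<in> {0..1}" and y: "y \<in> {0..1}"
  have j: "0 < j" using assms(1) by simp
  have B: "0 \<le> Bernstein n i x" "0 \<le> Bernstein m k y" for i k
    using x y by (auto intro: Bernstein_nonneg)
  have "f (x, y) \<le> (\<Sum>i\<le>n. Bernstein n i x * f (akr_node j n i, y))"
    using K1_le_akr[OF j assms(2) _ x, of "\<lambda>x. f (x, y)"] assms(4) y by (simp add: K2_def)
  also have "\<dots> \<le> (\<Sum>i\<le>n. Bernstein n i x *
      (\<Sum>k\<le>m. Bernstein m k y * f (akr_node j n i, akr_node j m k)))"
  proof (intro sum_mono mult_left_mono B)
    fix i assume "i \<in> {..n}"
    then have "akr_node j n i \<in> {0..1}"
      using akr_node_in_unit[OF j] by simp
    then have "(\<lambda>y. f (akr_node j n i, y)) \<in> K1 j"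
      using assms(4) by (simp add: K2_def)
    from K1_le_akr[OF j assms(3) this y]
    show "f (akr_node j n i, y) \<le>
        (\<Sum>k\<le>m. Bernstein m k y * f (akr_node j n i, akr_node j m k))" .
  qed
  also have "\<dots> = akr_op2 n m j f (x, y)"
    by (simp add: akr_op2_def sum_distrib_left atLeast0AtMost mult_ac)
  finally show "f (x, y) \<le> akr_op2 n m j f (x, y)" .
  show "akr_op2 n m j f (x, y) \<le> bernstein_op2 n m f (x, y)"
    unfolding akr_op2_def bernstein_op2_def prod.case
  proof (intro sum_mono mult_right_mono B)
    fix i k assume "i \<in> {0..n}" "k \<in> {0..m}"
    then have "i \<le> n" "k \<le> m" by auto
    then show "f (akr_node j n i, akr_node j m k) \<le> f (real i / real n, real k / real m)"
      using akr_node_in_unit[OF j] akr_node_le[OF j assms(2)] akr_node_le[OF j assms(3)]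
      by (intro K2_mono[OF assms(4)]) (auto simp: divide_le_eq)
  qed
qed

end
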